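(* Let $X$ and $Y$ be coarsely equivalent metric spaces, and let $x_0\in X$ and $y_0\in Y$ be basepoints. Then the direct sequences $\text{ind-}\sigma(X,x_0)=\{\sigma_N(X,x_0),\phi_N\}_{N\in\mathbb N}$ and $\text{ind-}\sigma(Y,y_0)=\{\sigma_N(Y,y_0),\psi_N\}_{N\in\mathbb N}$ are equivalent.
   Context: Here $\mathbb N=\{1,2,3,\ldots\}$. Coarse notions. Let $X,Y$ be metric spaces. A (not necessarily continuous) function $f:X\to Y$ is bornologous if for each $N>0$ there is an $M>0$ such that for all $x,y\in X$, $d(x,y)\le N$ implies $d(f(x),f(y))\le M$. It is (metrically) proper if the inverse image of every bounded set is bounded. It is coarse if it is bornologous and proper. Two functions $f,g:X\to Y$ are close if there is a constant $K$ with $d(f(x),g(x))\le K$ for all $x\in X$. $X$ and $Y$ are coarsely equivalent if there are coarse functions $f:X\to Y$ and $g:Y\to X$ such that $g\circ f$ is close to the identity of $X$ and $f\circ g$ is close to the identity of $Y$. The sets $\sigma_N$. Let $X$ be a metric space, $x_0\in X$, $N>0$. An $N$-sequence in $X$ based at $x_0$ is an infinite sequence $x_0,x_1,x_2,\ldots$ of points of $X$ (with initial term $x_0$) such that $d(x_i,x_{i+1})\le N$ for all $i\ge 0$. It goes to infinity if $\lim_{i\to\infty}d(x_i,x_0)=\infty$. For $N$-sequences $s,t$ based at $x_0$ that go to infinity, write $s\sim t$ if $s$ is a subsequence of $t$ or $t$ is a subsequence of $s$; write $s\approx t$ if there is a finite list $s_1,\ldots,s_n$ of $N$-sequences in $X$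 based at $x_0$ going to infinity with $s\sim s_1\sim\cdots\sim s_n\sim t$. Then $\approx$ is an equivalence relation; $[s]_N$ denotes the class of $s$ and $\sigma_N(X,x_0)$ the set of classes. For each $N\in\mathbb N$ the bonding function $\sigma_N(X,x_0)\to\sigma_{N+1}(X,x_0)$ sends $[s]_N$ to $[s]_{N+1}$. The resulting direct sequence is denoted $\text{ind-}\sigma(X,x_0)$. Direct sequences. A direct sequence of sets is a family of sets $\{X_i\}_{i\in\mathbb N}$ with functions $\phi_i:X_i\to X_{i+1}$; for $i<j$ put $\phi_{ij}=\phi_{j-1}\circ\cdots\circ\phi_i:X_i\to X_j$, and $\phi_{ii}=\mathrm{id}$. A morphism from $\{X_i,\phi_i\}$ to $\{Y_i,\psi_i\}$ consists of a nondecreasing function $u:\mathbb N\to\mathbb N$ and functions $f_i:X_i\to Y_{u(i)}$ such that $\psi_{u(i)u(j)}\circ f_i=f_j\circ\phi_{ij}$ whenever $i<j$. Two direct sequences $\{X_i,\phi_i\}$, $\{Y_i,\psi_i\}$ are equivalent if there are morphisms $\{f_i:X_i\to Y_{u(i)}\}$ and $\{g_i:Y_i\to X_{v(i)}\}$ such that, for all $i$, $v(u(i))\ge i$, $u(v(i))\ge i$, $g_{u(i)}\circ f_i=\phi_{i\,v(u(i))}$ and $f_{v(i)}\circ g_i=\psi_{i\,u(v(i))}$. *)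

theory Defs
  imports "HOL-Analysis.Analysis"
begin

definition bornologous :: "'a metric \<Rightarrow> 'b metric \<Rightarrow> ('a \<Rightarrow> 'b) \<Rightarrow> bool" where
  "bornologous X Y f \<longleftrightarrow>
     (\<forall>N>0. \<exists>M>0. \<forall>x\<in>mspace X. \<forall>y\<in>mspace X. mdist X x y \<le> N \<longrightarrow> mdist Y (f x) (f y) \<le> M)"

definition metrically_proper :: "'a metric \<Rightarrow> 'b metric \<Rightarrow> ('a \<Rightarrow> 'b) \<Rightarrow> bool" where
  "metrically_proper X Y f \<longleftrightarrow>
     (\<forall>B. Metric_space.mbounded (mspace Y) (mdist Y) B \<longrightarrow>
          Metric_space.mbounded (mspace X) (mdist X) (f -` B \<inter> mspace X))"

definition coarse :: "'a metric \<Rightarrow> 'b metric \<Rightarrow> ('a \<Rightarrow> 'b) \<Rightarrow> bool" where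
  "coarse X Y f \<longleftrightarrow>
     f \<in> mspace X \<rightarrow> mspace Y \<and> bornologous X Y f \<and> metrically_proper X Y f"

definition close_maps :: "'a metric \<Rightarrow> 'b metric \<Rightarrow> ('a \<Rightarrow> 'b) \<Rightarrow> ('a \<Rightarrow> 'b) \<Rightarrow> bool" where
  "close_maps X Y f g \<longleftrightarrow> (\<exists>K. \<forall>x\<in>mspace X. mdist Y (f x) (g x) \<le> K)"

definition coarsely_equivalent :: "'a metric \<Rightarrow> 'b metric \<Rightarrow> bool" where
  "coarsely_equivalent X Y \<longleftrightarrow>
     (\<exists>f g. coarse X Y f \<and> coarse Y X g \<and>
            close_maps X X (g \<circ> f) id \<and> close_maps Y Y (f \<circ> g) id)"

text \<open>The \<open>N\<close>-sequences based at \<open>x0\<close> that go to infinity.\<close>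

definition inf_seqs :: "'a metric \<Rightarrow> 'a \<Rightarrow> real \<Rightarrow> (nat \<Rightarrow> 'a) set" where
  "inf_seqs X x0 N =
     {s. range s \<subseteq> mspace X \<and> s 0 = x0 \<and> (\<forall>i. mdist X (s i) (s (Suc i)) \<le> N) \<and>
         filterlim (\<lambda>i. mdist X (s i) x0) at_top sequentially}"

definition is_subseq :: "(nat \<Rightarrow> 'a) \<Rightarrow> (nat \<Rightarrow> 'a) \<Rightarrow> bool" where
  "is_subseq s t \<longleftrightarrow> (\<exists>r. strict_mono r \<and> s = t \<circ> r)"

definition seq_sim :: "(nat \<Rightarrow> 'a) \<Rightarrow> (nat \<Rightarrow> 'a) \<Rightarrow> bool" where
  "seq_sim s t \<longleftrightarrow> is_subseq s t \<or> is_subseq t s"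

text \<open>The relation \<open>\<approx>\<close>. Allowing the list of intermediate sequences to be empty changes
  nothing, as \<^const>\<open>seq_sim\<close> is reflexive.\<close>

definition seq_equiv :: "'a metric \<Rightarrow> 'a \<Rightarrow> real \<Rightarrow> ((nat \<Rightarrow> 'a) \<times> (nat \<Rightarrow> 'a)) set" where
  "seq_equiv X x0 N =
     {(s, t). s \<in> inf_seqs X x0 N \<and> t \<in> inf_seqs X x0 N \<and>
        (\<exists>ss. set ss \<subseteq> inf_seqs X x0 N \<and> successively seq_sim (s # ss @ [t]))}"

definition seq_class :: "'a metric \<Rightarrow> 'a \<Rightarrow> real \<Rightarrow> (nat \<Rightarrow> 'a) \<Rightarrow> (nat \<Rightarrow> 'a) set" where
  "seq_class X x0 N s = seq_equiv X x0 N `` {s}"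

definition sigma_classes :: "'a metric \<Rightarrow> 'a \<Rightarrow> real \<Rightarrow> (nat \<Rightarrow> 'a) set set" where
  "sigma_classes X x0 N = inf_seqs X x0 N // seq_equiv X x0 N"

text \<open>Direct sequences of sets. The index set is \<open>{1, 2, 3, \<dots>}\<close>, so only the components with
  index at least 1 are meaningful; likewise a bonding function matters only on its domain.\<close>

record 'a dirseq =
  obj :: "nat \<Rightarrow> 'a set"
  bond :: "nat \<Rightarrow> 'a \<Rightarrow> 'a"

definition direct_sequence :: "'a dirseq \<Rightarrow> bool" where
  "direct_sequence D \<longleftrightarrow> (\<forall>i\<ge>1. bond D i \<in> obj D i \<rightarrow> obj D (Suc i))"

text \<open>The composite \<open>\<phi>\<^bsub>j-1\<^esub> \<circ> \<dots> \<circ> \<phi>\<^bsub>i\<^esub>\<close>, to be used for \<open>i \<le> j\<close> only.\<close>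

definition bonds :: "'a dirseq \<Rightarrow> nat \<Rightarrow> nat \<Rightarrow> 'a \<Rightarrow> 'a" where
  "bonds D i j = fold (bond D) [i..<j]"

definition dirseq_morphism ::
  "'a dirseq \<Rightarrow> 'b dirseq \<Rightarrow> (nat \<Rightarrow> nat) \<Rightarrow> (nat \<Rightarrow> 'a \<Rightarrow> 'b) \<Rightarrow> bool" where
  "dirseq_morphism D E u f \<longleftrightarrow>
     u \<in> {1..} \<rightarrow> {1..} \<and> mono_on {1..} u \<and>
     (\<forall>i\<ge>1. f i \<in> obj D i \<rightarrow> obj E (u i)) \<and>
     (\<forall>i\<ge>1. \<forall>j>i. \<forall>x\<in>obj D i. bonds E (u i) (u j) (f i x) = f j (bonds D i j x))"

definition dirseq_equivalent :: "'a dirseq \<Rightarrow> 'b dirseq \<Rightarrow> bool" where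
  "dirseq_equivalent D E \<longleftrightarrow>
     direct_sequence D \<and> direct_sequence E \<and>
     (\<exists>u f v g. dirseq_morphism D E u f \<and> dirseq_morphism E D v g \<and>
        (\<forall>i\<ge>1. v (u i) \<ge> i \<and> u (v i) \<ge> i \<and>
           (\<forall>x\<in>obj D i. g (u i) (f i x) = bonds D i (v (u i)) x) \<and>
           (\<forall>y\<in>obj E i. f (v i) (g i y) = bonds E i (u (v i)) y)))"

text \<open>The bonding function is the usual lift to the quotient; \<open>bond_ind_sigma\<close> below confirms
  that it sends \<open>[s]\<^sub>N\<close> to \<open>[s]\<^bsub>N+1\<^esub>\<close>.\<close>

definition ind_sigma :: "'a metric \<Rightarrow> 'a \<Rightarrow> (nat \<Rightarrow> 'a) set dirseq" where
  "ind_sigma X x0 =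
     \<lparr>obj = (\<lambda>N. sigma_classes X x0 (real N)),
      bond = (\<lambda>N c. \<Union>s\<in>c. seq_class X x0 (real (Suc N)) s)\<rparr>"

lemma seq_sim_refl: "seq_sim s s"
  unfolding seq_sim_def is_subseq_def by (intro disjI1 exI[of _ id]) (auto simp: strict_mono_def)

lemma equiv_seq_equiv: "equiv (inf_seqs X x0 N) (seq_equiv X x0 N)"
proof (rule equivI)
  show "seq_equiv X x0 N \<subseteq> inf_seqs X x0 N \<times> inf_seqs X x0 N"
    by (auto simp: seq_equiv_def)
  show "refl_on (inf_seqs X x0 N) (seq_equiv X x0 N)"
    by (rule refl_onI) (auto simp: seq_equiv_def seq_sim_refl intro!: exI[of _ "[]"])
  have sym: "successively seq_sim (rev xs)" if "successively seq_sim xs" for xs :: "(nat \<Rightarrow> 'a) list"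
    unfolding successively_rev using that
    by (rule successively_mono) (auto simp: seq_sim_def)
  show "sym (seq_equiv X x0 N)"
  proof (rule symI)
    fix s t assume "(s, t) \<in> seq_equiv X x0 N"
    then obtain ss where st: "s \<in> inf_seqs X x0 N" "t \<in> inf_seqs X x0 N"
      and ss: "set ss \<subseteq> inf_seqs X x0 N" "successively seq_sim (s # ss @ [t])"
      by (auto simp: seq_equiv_def)
    from sym[OF ss(2)] have "successively seq_sim (t # rev ss @ [s])" by simp
    with st ss(1) show "(t, s) \<in> seq_equiv X x0 N"
      unfolding seq_equiv_def by (auto intro!: exI[of _ "rev ss"])
  qed
  show "trans (seq_equiv X x0 N)"
  proof (rule transI)
    fix s t w assume "(s, t) \<in> seq_equiv X x0 N" "(t, w) \<in> seq_equiv X x0 N"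
    then obtain ss ts where st: "s \<in> inf_seqs X x0 N" "t \<in> inf_seqs X x0 N" "w \<in> inf_seqs X x0 N"
      and ss: "set ss \<subseteq> inf_seqs X x0 N" "successively seq_sim (s # ss @ [t])"
      and ts: "set ts \<subseteq> inf_seqs X x0 N" "successively seq_sim (t # ts @ [w])"
      by (auto simp: seq_equiv_def)
    have "successively seq_sim ((s # ss) @ (t # ts @ [w]))"
      using ss(2) ts(2) successively_append_iff[of seq_sim "s # ss" "[t]"]
      by (subst successively_append_iff) auto
    then have "successively seq_sim (s # (ss @ t # ts) @ [w])" by simp
    with st ss(1) ts(1) show "(s, w) \<in> seq_equiv X x0 N"
      unfolding seq_equiv_def by (auto intro!: exI[of _ "ss @ t # ts"])
  qed
qed

lemma inf_seqs_mono: "M \<le> N \<Longrightarrow> inf_seqs X x0 M \<subseteq> inf_seqs X x0 N"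
  unfolding inf_seqs_def by (blast intro: order_trans)

lemma seq_equiv_mono: "M \<le> N \<Longrightarrow> seq_equiv X x0 M \<subseteq> seq_equiv X x0 N"
  using inf_seqs_mono[of M N X x0] unfolding seq_equiv_def by blast

lemma bond_ind_sigma:
  assumes "s \<in> inf_seqs X x0 (real N)"
  shows "bond (ind_sigma X x0) N (seq_class X x0 (real N) s) = seq_class X x0 (real (Suc N)) s"
proof -
  have "seq_class X x0 (real (Suc N)) t = seq_class X x0 (real (Suc N)) s"
    if "t \<in> seq_class X x0 (real N) s" for t
  proof -
    have "(s, t) \<in> seq_equiv X x0 (real (Suc N))"
      using that seq_equiv_mono[of "real N" "real (Suc N)" X x0] by (auto simp: seq_class_def)
    then show ?thesis
      unfolding seq_class_def by (rule equiv_class_eq[OF equiv_seq_equiv, symmetric])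
  qed
  moreover have "s \<in> seq_class X x0 (real N) s"
    unfolding seq_class_def by (rule equiv_class_self[OF equiv_seq_equiv assms])
  ultimately have "(\<Union>t\<in>seq_class X x0 (real N) s. seq_class X x0 (real (Suc N)) t) =
      seq_class X x0 (real (Suc N)) s"
    by blast
  then show ?thesis unfolding ind_sigma_def by simp
qed

lemma direct_sequence_ind_sigma: "direct_sequence (ind_sigma X x0)"
  unfolding direct_sequence_def
proof (intro allI impI funcsetI)
  fix N c assume "c \<in> obj (ind_sigma X x0) N"
  then obtain s where s: "s \<in> inf_seqs X x0 (real N)" and c: "c = seq_class X x0 (real N) s"
    by (auto simp: ind_sigma_def sigma_classes_def seq_class_def elim!: quotientE)
  have "s \<in> inf_seqs X x0 (real (Suc N))"
    using s inf_seqs_mono[of "real N" "real (Suc N)" X x0] by auto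
  then show "bond (ind_sigma X x0) N c \<in> obj (ind_sigma X x0) (Suc N)"
    unfolding c bond_ind_sigma[OF s]
    by (simp add: ind_sigma_def sigma_classes_def seq_class_def quotientI del: of_nat_Suc)
qed

end

theory Submission
  imports Defs
begin

text \<open>
  Change a coarse equivalence \<open>f\<close>, \<open>g\<close> at a single point each, so that \<open>f x0 = y0\<close> and
  \<open>g y0 = x0\<close>. The new maps are close to the old ones, so they still form a coarse equivalence
  (\<open>pointed_coarse_equivalence\<close>); the gain is that \<open>s \<mapsto> f \<circ> s\<close> now takes based sequences to based
  sequences. As this operation is post-composition, it commutes with passing to subsequences. It
  keeps sequences that go to infinity because \<open>f\<close> is proper, and turns \<open>N\<close>-sequences into
  \<open>u N\<close>-sequences because \<open>f\<close> is bornologous. So it descends to the classes and commutes with the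
  bonding functions.

  The composite \<open>g \<circ> f\<close> moves points by at most some \<open>K\<close>. A sequence \<open>s\<close> and its image \<open>t\<close> under
  \<open>g \<circ> f\<close> are both subsequences of the interleaving \<open>s 0, t 0, s 1, t 1, \<dots>\<close>, whose steps have
  length at most \<open>N + K\<close> (\<open>seq_equiv_of_uniformly_close\<close>). So \<open>s\<close> and \<open>t\<close> have the same class as
  soon as the level is at least \<open>N + K\<close>, and this is arranged by letting the index functions grow
  fast enough (\<open>coarse_control_function\<close>).
\<close>

section \<open>Pointed coarse equivalences\<close>

lemma mbounded_mspace_iff:
  assumes "a \<in> mspace X"
  shows "Metric_space.mbounded (mspace X) (mdist X) S \<longleftrightarrow>
    S \<subseteq> mspace X \<and> (\<exists>R. \<forall>x\<in>S. mdist X x a \<le> R)"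
proof -
  interpret Metric_space "mspace X" "mdist X"
    by (rule Metric_space_mspace_mdist)
  show ?thesis
  proof
    assume "mbounded S"
    then show "S \<subseteq> mspace X \<and> (\<exists>R. \<forall>x\<in>S. mdist X x a \<le> R)"
      using mbounded_subset_mspace mbounded_alt[of "insert a S"] mbounded_insert[of a S] assms
      by blast
  next
    assume "S \<subseteq> mspace X \<and> (\<exists>R. \<forall>x\<in>S. mdist X x a \<le> R)"
    then obtain R where "S \<subseteq> mcball a R"
      using assms by (auto simp: subset_iff mdist_commute)
    then show "mbounded S"
      by (auto simp: mbounded_def)
  qed
qed

definition controlled :: "'a metric \<Rightarrow> 'b metric \<Rightarrow> ('a \<Rightarrow> 'b) \<Rightarrow> real \<Rightarrow> real \<Rightarrow> bool" where
  "controlled X Y f N M \<longleftrightarrow>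
     (\<forall>x\<in>mspace X. \<forall>y\<in>mspace X. mdist X x y \<le> N \<longrightarrow> mdist Y (f x) (f y) \<le> M)"

lemma bornologous_iff_controlled:
  "bornologous X Y f \<longleftrightarrow> (\<forall>N>0. \<exists>M>0. controlled X Y f N M)"
  by (simp add: bornologous_def controlled_def)

lemma close_maps_trans:
  assumes "close_maps X Y f g" "close_maps X Y g h"
    and "f \<in> mspace X \<rightarrow> mspace Y" "g \<in> mspace X \<rightarrow> mspace Y" "h \<in> mspace X \<rightarrow> mspace Y"
  shows "close_maps X Y f h"
proof -
  obtain K L where K: "\<And>x. x \<in> mspace X \<Longrightarrow> mdist Y (f x) (g x) \<le> K"
    and L: "\<And>x. x \<in> mspace X \<Longrightarrow> mdist Y (g x) (h x) \<le> L"
    using assms(1,2) unfolding close_maps_def by blast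
  have "mdist Y (f x) (h x) \<le> K + L" if "x \<in> mspace X" for x
    using mdist_triangle[of "f x" Y "g x" "h x"] K[OF that] L[OF that] assms that
    by (fastforce simp: Pi_iff)
  then show ?thesis
    by (auto simp: close_maps_def)
qed

lemma close_maps_sym: "close_maps X Y f g \<Longrightarrow> close_maps X Y g f"
  by (simp add: close_maps_def mdist_commute)

lemma close_maps_comp:
  assumes ff': "close_maps X Y f f'" and gg': "close_maps Y Z g g'"
    and f: "f \<in> mspace X \<rightarrow> mspace Y" and f': "f' \<in> mspace X \<rightarrow> mspace Y"
    and g: "g \<in> mspace Y \<rightarrow> mspace Z" "bornologous Y Z g" and g': "g' \<in> mspace Y \<rightarrow> mspace Z"
  shows "close_maps X Z (g \<circ> f) (g' \<circ> f')"
proof (rule close_maps_trans)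
  obtain K where K: "\<And>x. x \<in> mspace X \<Longrightarrow> mdist Y (f x) (f' x) \<le> K"
    using ff' by (auto simp: close_maps_def)
  have "max K 1 > 0"
    by simp
  then obtain M where "controlled Y Z g (max K 1) M"
    using g(2) unfolding bornologous_iff_controlled by blast
  moreover have "mdist Y (f x) (f' x) \<le> max K 1" if "x \<in> mspace X" for x
    using K[OF that] by simp
  ultimately show "close_maps X Z (g \<circ> f) (g \<circ> f')"
    using f f' unfolding close_maps_def controlled_def by (intro exI[of _ M]) (auto simp: Pi_iff)
  show "close_maps X Z (g \<circ> f') (g' \<circ> f')"
    using gg' f' by (auto simp: close_maps_def Pi_iff)
qed (use f f' g g' in auto)

text \<open>
  If \<open>f\<close> and \<open>g\<close> differ by at most \<open>K\<close>, then a bound \<open>M\<close> for \<open>f\<close> gives the bound \<open>M + 2 K\<close> for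
  \<open>g\<close>, and the preimage under \<open>g\<close> of a ball of radius \<open>R\<close> lies in the preimage under \<open>f\<close> of the
  concentric ball of radius \<open>K + R\<close>.
\<close>

lemma coarse_if_close_maps:
  assumes f: "coarse X Y f" and fg: "close_maps X Y f g" and g: "g \<in> mspace X \<rightarrow> mspace Y"
  shows "coarse X Y g"
proof -
  have fX: "\<And>x. x \<in> mspace X \<Longrightarrow> f x \<in> mspace Y" and gX: "\<And>x. x \<in> mspace X \<Longrightarrow> g x \<in> mspace Y"
    using f g by (auto simp: coarse_def)
  obtain K0 where "\<And>x. x \<in> mspace X \<Longrightarrow> mdist Y (f x) (g x) \<le> K0"
    using fg unfolding close_maps_def by blast
  then obtain K where "K \<ge> 0" and K: "\<And>x. x \<in> mspace X \<Longrightarrow> mdist Y (f x) (g x) \<le> K"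
    using that[of "max K0 0"] by fastforce
  have "bornologous X Y g"
    unfolding bornologous_def
  proof (intro allI impI)
    fix N :: real assume "N > 0"
    then obtain M where "M > 0" and M: "controlled X Y f N M"
      using f unfolding coarse_def bornologous_iff_controlled by blast
    have "mdist Y (g x) (g y) \<le> K + M + K"
      if "x \<in> mspace X" "y \<in> mspace X" "mdist X x y \<le> N" for x y
    proof -
      have "mdist Y (f x) (f y) \<le> M"
        using M that by (simp add: controlled_def)
      moreover have "mdist Y (g x) (f x) \<le> K"
        using K[of x] that by (simp add: mdist_commute)
      moreover have "mdist Y (g x) (g y) \<le> mdist Y (g x) (f x) + mdist Y (f x) (g y)"
        "mdist Y (f x) (g y) \<le> mdist Y (f x) (f y) + mdist Y (f y) (g y)"
        by (simp_all add: mdist_triangle that fX gX)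
      ultimately show ?thesis
        using K[of y] that by linarith
    qed
    then show "\<exists>M>0. \<forall>x\<in>mspace X. \<forall>y\<in>mspace X. mdist X x y \<le> N \<longrightarrow> mdist Y (g x) (g y) \<le> M"
      using \<open>M > 0\<close> \<open>K \<ge> 0\<close> by (intro exI[of _ "K + M + K"]) auto
  qed
  moreover have "metrically_proper X Y g"
    unfolding metrically_proper_def
  proof (intro allI impI)
    fix B assume B: "Metric_space.mbounded (mspace Y) (mdist Y) B"
    interpret X: Metric_space "mspace X" "mdist X" by (rule Metric_space_mspace_mdist)
    show "X.mbounded (g -` B \<inter> mspace X)"
    proof (cases "B = {}")
      case False
      then obtain b where b: "b \<in> mspace Y"
        using B Metric_space.mbounded_subset_mspace[OF Metric_space_mspace_mdist] by blast
      then obtain R where R: "\<And>y. y \<in> B \<Longrightarrow> mdist Y y b \<le> R"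
        using B by (auto simp: mbounded_mspace_iff)
      let ?C = "{y \<in> mspace Y. mdist Y y b \<le> K + R}"
      have "Metric_space.mbounded (mspace Y) (mdist Y) ?C"
        using b by (auto simp: mbounded_mspace_iff)
      then have "X.mbounded (f -` ?C \<inter> mspace X)"
        using f by (auto simp: coarse_def metrically_proper_def)
      moreover have "mdist Y (f x) b \<le> K + R" if "x \<in> mspace X" "g x \<in> B" for x
        using mdist_triangle[of "f x" Y "g x" b] K[of x] R[of "g x"] that fX gX b by fastforce
      then have "g -` B \<inter> mspace X \<subseteq> f -` ?C \<inter> mspace X"
        using fX by auto
      ultimately show ?thesis
        by (rule X.mbounded_subset)
    qed simp
  qed
  ultimately show ?thesis
    using g by (simp add: coarse_def)
qed

lemma close_maps_fun_upd:
  "f \<in> mspace X \<rightarrow> mspace Y \<Longrightarrow> close_maps X Y f (f(a := b))"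
  unfolding close_maps_def
proof (intro exI[of _ "mdist Y (f a) b"] ballI)
  fix x assume "f \<in> mspace X \<rightarrow> mspace Y" "x \<in> mspace X"
  then have "mdist Y (f x) (f x) = 0"
    by (simp add: Pi_iff)
  then show "mdist Y (f x) ((f(a := b)) x) \<le> mdist Y (f a) b"
    by simp
qed

lemma pointed_coarse_equivalence:
  assumes "coarsely_equivalent X Y" and x0: "x0 \<in> mspace X" and y0: "y0 \<in> mspace Y"
  obtains f g where "coarse X Y f" "coarse Y X g" "f x0 = y0" "g y0 = x0"
    "close_maps X X (g \<circ> f) id" "close_maps Y Y (f \<circ> g) id"
proof -
  obtain f g where f: "coarse X Y f" and g: "coarse Y X g"
    and gf: "close_maps X X (g \<circ> f) id" and fg: "close_maps Y Y (f \<circ> g) id"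
    using assms by (auto simp: coarsely_equivalent_def)
  define f' where "f' = f(x0 := y0)"
  define g' where "g' = g(y0 := x0)"
  have fX: "f \<in> mspace X \<rightarrow> mspace Y" "bornologous X Y f"
    and gY: "g \<in> mspace Y \<rightarrow> mspace X" "bornologous Y X g"
    using f g by (auto simp: coarse_def)
  have f'X: "f' \<in> mspace X \<rightarrow> mspace Y" and g'Y: "g' \<in> mspace Y \<rightarrow> mspace X"
    using fX gY x0 y0 by (auto simp: f'_def g'_def)
  have ff': "close_maps X Y f f'" and gg': "close_maps Y X g g'"
    unfolding f'_def g'_def using fX gY x0 y0 by (auto intro!: close_maps_fun_upd)
  show ?thesis
  proof
    show "coarse X Y f'" "coarse Y X g'"
      using coarse_if_close_maps f g ff' gg' f'X g'Y by blast+
    show "f' x0 = y0" "g' y0 = x0"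
      by (simp_all add: f'_def g'_def)
    have "close_maps X X (g' \<circ> f') (g \<circ> f)"
      using close_maps_comp[OF ff' gg' fX(1) f'X gY g'Y] by (rule close_maps_sym)
    then show "close_maps X X (g' \<circ> f') id"
      by (rule close_maps_trans[OF _ gf]) (use f'X g'Y fX gY in auto)
    have "close_maps Y Y (f' \<circ> g') (f \<circ> g)"
      using close_maps_comp[OF gg' ff' gY(1) g'Y fX f'X] by (rule close_maps_sym)
    then show "close_maps Y Y (f' \<circ> g') id"
      by (rule close_maps_trans[OF _ fg]) (use f'X g'Y fX gY in auto)
  qed
qed

section \<open>Sequences going to infinity under coarse maps\<close>

text \<open>
  The bounds for the levels up to \<open>n\<close> are added up to make the control function monotone. The
  summand \<open>K\<close> leaves room for a perturbation of size \<open>K\<close>.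
\<close>

lemma coarse_control_function:
  fixes K :: real
  assumes "bornologous X Y f"
  obtains u :: "nat \<Rightarrow> nat" where "mono u" "\<And>n. real n + K \<le> real (u n)" "\<And>n. n \<le> u n"
    "\<And>n. 1 \<le> n \<Longrightarrow> controlled X Y f (real n) (real (u n))"
proof -
  have "\<exists>M. 1 \<le> n \<longrightarrow> controlled X Y f (real n) M" for n
  proof (cases n)
    case (Suc k)
    then have "real n > 0" by simp
    then show ?thesis
      using assms unfolding bornologous_iff_controlled by blast
  qed simp
  then obtain M where M: "\<And>n. 1 \<le> n \<Longrightarrow> controlled X Y f (real n) (M n)"
    by metis
  define u where "u n = n + nat \<lceil>K\<rceil> + (\<Sum>k\<le>n. nat \<lceil>M k\<rceil>)" for n :: nat
  show ?thesis
  proof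
    show "mono u"
      unfolding u_def by (intro monoI add_mono sum_mono2) auto
    show "n \<le> u n" for n
      by (simp add: u_def)
    have "K \<le> real (nat \<lceil>K\<rceil>)"
      by (rule real_nat_ceiling_ge)
    then show "real n + K \<le> real (u n)" for n
      by (simp add: u_def add_increasing2 sum_nonneg)
    have "M n \<le> real (u n)" for n
    proof -
      have "nat \<lceil>M n\<rceil> \<le> (\<Sum>k\<le>n. nat \<lceil>M k\<rceil>)"
        by (rule member_le_sum) auto
      then have "nat \<lceil>M n\<rceil> \<le> u n"
        by (simp add: u_def)
      then show ?thesis
        using real_nat_ceiling_ge[of "M n"] by linarith
    qed
    then show "controlled X Y f (real n) (real (u n))" if "1 \<le> n" for n
      using M[OF that] unfolding controlled_def by (meson order_trans)
  qed
qed

text \<open>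
  The preimage of a ball about \<open>y0\<close> lies in some ball about \<open>x0\<close>, and \<open>s\<close> eventually leaves the
  latter.
\<close>

lemma proper_map_to_infinity:
  assumes f: "metrically_proper X Y f" "f \<in> mspace X \<rightarrow> mspace Y"
    and s: "range s \<subseteq> mspace X" "filterlim (\<lambda>i. mdist X (s i) x0) at_top sequentially"
    and x0: "x0 \<in> mspace X" and y0: "y0 \<in> mspace Y"
  shows "filterlim (\<lambda>i. mdist Y (f (s i)) y0) at_top sequentially"
  unfolding filterlim_at_top_dense
proof
  fix C :: real
  let ?B = "{y \<in> mspace Y. mdist Y y y0 \<le> C}"
  have "Metric_space.mbounded (mspace Y) (mdist Y) ?B"
    using y0 by (auto simp: mbounded_mspace_iff)
  then have "Metric_space.mbounded (mspace X) (mdist X) (f -` ?B \<inter> mspace X)"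
    using f(1) unfolding metrically_proper_def by blast
  then obtain R where R: "\<And>x. x \<in> mspace X \<Longrightarrow> f x \<in> ?B \<Longrightarrow> mdist X x x0 \<le> R"
    unfolding mbounded_mspace_iff[OF x0] by blast
  have "\<forall>\<^sub>F i in sequentially. R < mdist X (s i) x0"
    using s(2) by (simp add: filterlim_at_top_dense)
  then show "\<forall>\<^sub>F i in sequentially. C < mdist Y (f (s i)) y0"
  proof eventually_elim
    case (elim i)
    have "s i \<in> mspace X" using s by auto
    with elim R[of "s i"] f(2) show ?case
      by (auto simp: Pi_iff not_le[symmetric])
  qed
qed

lemma coarse_comp_inf_seqs:
  assumes f: "coarse X Y f" and x0: "x0 \<in> mspace X"
    and bound: "controlled X Y f N M"
    and s: "s \<in> inf_seqs X x0 N"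
  shows "f \<circ> s \<in> inf_seqs Y (f x0) M"
proof -
  have fX: "f \<in> mspace X \<rightarrow> mspace Y" and f_proper: "metrically_proper X Y f"
    using f by (simp_all add: coarse_def)
  have sX: "range s \<subseteq> mspace X" and s_inf: "filterlim (\<lambda>i. mdist X (s i) x0) at_top sequentially"
    and s_step: "\<And>i. mdist X (s i) (s (Suc i)) \<le> N" and "s 0 = x0"
    using s by (simp_all add: inf_seqs_def)
  have s_in: "s i \<in> mspace X" for i
    using sX by blast
  have "f x0 \<in> mspace Y"
    using fX x0 by blast
  then have "filterlim (\<lambda>i. mdist Y (f (s i)) (f x0)) at_top sequentially"
    by (rule proper_map_to_infinity[OF f_proper fX sX s_inf x0])
  moreover have "range (f \<circ> s) \<subseteq> mspace Y"
    using fX s_in by auto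
  moreover have "mdist Y (f (s i)) (f (s (Suc i))) \<le> M" for i
    using bound s_step s_in by (simp add: controlled_def)
  ultimately show ?thesis
    using \<open>s 0 = x0\<close> by (simp add: inf_seqs_def)
qed

lemma seq_sim_comp: "seq_sim s t \<Longrightarrow> seq_sim (f \<circ> s) (f \<circ> t)"
  unfolding seq_sim_def is_subseq_def by (metis comp_assoc)

lemma coarse_comp_seq_equiv:
  assumes f: "coarse X Y f" and x0: "x0 \<in> mspace X"
    and bound: "controlled X Y f N M"
    and st: "(s, t) \<in> seq_equiv X x0 N"
  shows "(f \<circ> s, f \<circ> t) \<in> seq_equiv Y (f x0) M"
proof -
  note inf = coarse_comp_inf_seqs[OF f x0 bound]
  obtain ss where ss: "set ss \<subseteq> inf_seqs X x0 N" "successively seq_sim (s # ss @ [t])"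
    and "s \<in> inf_seqs X x0 N" "t \<in> inf_seqs X x0 N"
    using st by (auto simp: seq_equiv_def)
  moreover have "set (map ((\<circ>) f) ss) \<subseteq> inf_seqs Y (f x0) M"
    using ss(1) inf by auto
  moreover have "successively seq_sim (map ((\<circ>) f) (s # ss @ [t]))"
    unfolding successively_map using ss(2)
    by (rule successively_mono) (auto intro: seq_sim_comp)
  ultimately show ?thesis
    using inf unfolding seq_equiv_def by (auto intro!: exI[of _ "map ((\<circ>) f) ss"])
qed

text \<open>
  Uniformly close sequences need not be subsequences of one another, but their interleaving
  contains both.
\<close>

lemma seq_equiv_of_uniformly_close:
  assumes s: "s \<in> inf_seqs X x0 N" and t: "t \<in> inf_seqs X x0 N'"
    and K: "\<And>i. mdist X (s i) (t i) \<le> K"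
    and L: "N \<le> L" "N' \<le> L" "N + K \<le> L"
  shows "(s, t) \<in> seq_equiv X x0 L"
proof -
  define w where "w n = (if even n then s (n div 2) else t (n div 2))" for n
  have sX: "\<And>i. s i \<in> mspace X" and tX: "\<And>i. t i \<in> mspace X"
    and s_step: "\<And>i. mdist X (s i) (s (Suc i)) \<le> N"
    and s_inf: "filterlim (\<lambda>i. mdist X (s i) x0) at_top sequentially"
    and t_inf: "filterlim (\<lambda>i. mdist X (t i) x0) at_top sequentially"
    using s t unfolding inf_seqs_def by blast+
  have "N \<ge> 0"
    using s_step[of 0] mdist_nonneg[of X "s 0" "s (Suc 0)"] by linarith
  have w_step: "mdist X (w n) (w (Suc n)) \<le> L" for n
  proof (cases "even n")
    case True
    then show ?thesis
      using K[of "n div 2"] L \<open>N \<ge> 0\<close> by (simp add: w_def)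
  next
    case False
    \<comment> \<open>An odd step leads from \<open>t i\<close> to \<open>s (i + 1)\<close>, and its length is estimated by a detour
      through \<open>s i\<close>.\<close>
    let ?i = "n div 2"
    have "mdist X (t ?i) (s (Suc ?i)) \<le> mdist X (t ?i) (s ?i) + mdist X (s ?i) (s (Suc ?i))"
      by (rule mdist_triangle) (auto simp: sX tX)
    also have "\<dots> \<le> K + N"
      using K[of ?i] s_step[of ?i] by (simp add: mdist_commute)
    finally show ?thesis
      using False L by (simp add: w_def)
  qed
  have half: "filterlim (\<lambda>n::nat. n div 2) sequentially sequentially"
    by (rule filterlim_at_top_div_const_nat) simp
  have w_inf: "filterlim (\<lambda>n. mdist X (w n) x0) at_top sequentially"
    unfolding filterlim_at_top
  proof
    fix C :: real
    have "\<forall>\<^sub>F n in sequentially. C \<le> mdist X (s (n div 2)) x0"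
      using filterlim_compose[OF s_inf half] by (simp add: filterlim_at_top)
    moreover have "\<forall>\<^sub>F n in sequentially. C \<le> mdist X (t (n div 2)) x0"
      using filterlim_compose[OF t_inf half] by (simp add: filterlim_at_top)
    ultimately show "\<forall>\<^sub>F n in sequentially. C \<le> mdist X (w n) x0"
      by eventually_elim (simp add: w_def)
  qed
  have "w \<in> inf_seqs X x0 L"
    using w_step w_inf sX tX s by (auto simp: inf_seqs_def w_def)
  moreover have "is_subseq s w"
    unfolding is_subseq_def
    by (intro exI[of _ "\<lambda>i. 2 * i"]) (auto simp: w_def fun_eq_iff strict_mono_def)
  moreover have "is_subseq t w"
    unfolding is_subseq_def
    by (intro exI[of _ "\<lambda>i. Suc (2 * i)"]) (auto simp: w_def fun_eq_iff strict_mono_def)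
  moreover have "s \<in> inf_seqs X x0 L" "t \<in> inf_seqs X x0 L"
    using subsetD[OF inf_seqs_mono[OF L(1)] s] subsetD[OF inf_seqs_mono[OF L(2)] t] by simp_all
  ultimately show ?thesis
    by (auto simp: seq_equiv_def seq_sim_def intro!: exI[of _ "[w]"])
qed

section \<open>The induced morphism of direct sequences\<close>

lemma seq_class_eqI: "(s, t) \<in> seq_equiv X x0 N \<Longrightarrow> seq_class X x0 N s = seq_class X x0 N t"
  unfolding seq_class_def by (rule equiv_class_eq[OF equiv_seq_equiv])

lemma seq_class_in_obj:
  "s \<in> inf_seqs X x0 (real N) \<Longrightarrow> seq_class X x0 (real N) s \<in> obj (ind_sigma X x0) N"
  by (simp add: ind_sigma_def sigma_classes_def seq_class_def quotientI)

lemma obj_ind_sigmaE: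
  assumes "c \<in> obj (ind_sigma X x0) N"
  obtains s where "s \<in> inf_seqs X x0 (real N)" "c = seq_class X x0 (real N) s"
  using assms by (auto simp: ind_sigma_def sigma_classes_def seq_class_def elim!: quotientE)

lemma bonds_ind_sigma:
  assumes "i \<le> j" and s: "s \<in> inf_seqs X x0 (real i)"
  shows "bonds (ind_sigma X x0) i j (seq_class X x0 (real i) s) = seq_class X x0 (real j) s"
  using \<open>i \<le> j\<close>
proof (induction rule: dec_induct)
  case base
  then show ?case by (simp add: bonds_def)
next
  case (step n)
  have "s \<in> inf_seqs X x0 (real n)"
    using s step.hyps inf_seqs_mono[of "real i" "real n" X x0] by auto
  from bond_ind_sigma[OF this] step show ?case
    by (simp add: bonds_def del: of_nat_Suc)
qed

definition map_classes ::
  "'b metric \<Rightarrow> 'b \<Rightarrow> real \<Rightarrow> ('a \<Rightarrow> 'b) \<Rightarrow> (nat \<Rightarrow> 'a) set \<Rightarrow> (nat \<Rightarrow> 'b) set" where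
  "map_classes Y y0 M f c = (\<Union>s\<in>c. seq_class Y y0 M (f \<circ> s))"

text \<open>
  Post-composition carries a chain of subsequence relations to such a chain, so all representatives
  in the union contribute the same class.
\<close>

lemma map_classes_seq_class:
  assumes f: "coarse X Y f" and x0: "x0 \<in> mspace X"
    and bound: "controlled X Y f N M"
    and s: "s \<in> inf_seqs X x0 N"
  shows "map_classes Y (f x0) M f (seq_class X x0 N s) = seq_class Y (f x0) M (f \<circ> s)"
proof -
  have "seq_class Y (f x0) M (f \<circ> t) = seq_class Y (f x0) M (f \<circ> s)"
    if "t \<in> seq_class X x0 N s" for t
    using seq_class_eqI[OF coarse_comp_seq_equiv[OF f x0 bound]] that
    by (auto simp: seq_class_def)
  moreover have "s \<in> seq_class X x0 N s"
    unfolding seq_class_def by (rule equiv_class_self[OF equiv_seq_equiv s])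
  ultimately show ?thesis
    unfolding map_classes_def by blast
qed

lemma dirseq_morphism_map_classes:
  assumes f: "coarse X Y f" and x0: "x0 \<in> mspace X" and "mono u" and u: "\<And>n. n \<le> u n"
    and bound: "\<And>n. 1 \<le> n \<Longrightarrow> controlled X Y f (real n) (real (u n))"
  shows "dirseq_morphism (ind_sigma X x0) (ind_sigma Y (f x0)) u
    (\<lambda>n. map_classes Y (f x0) (real (u n)) f)"
  unfolding dirseq_morphism_def
proof (intro conjI allI impI ballI)
  show "u \<in> {1..} \<rightarrow> {1..}"
    using u by (auto intro: order_trans)
  show "mono_on {1..} u"
    using \<open>mono u\<close> by (rule mono_on_subset) simp
next
  fix i :: nat assume "1 \<le> i"
  note comp = coarse_comp_inf_seqs[OF f x0 bound[OF \<open>1 \<le> i\<close>]]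
    and cls = map_classes_seq_class[OF f x0 bound[OF \<open>1 \<le> i\<close>]]
  show "map_classes Y (f x0) (real (u i)) f \<in> obj (ind_sigma X x0) i \<rightarrow> obj (ind_sigma Y (f x0)) (u i)"
  proof
    fix c assume "c \<in> obj (ind_sigma X x0) i"
    then obtain s where s: "s \<in> inf_seqs X x0 (real i)" "c = seq_class X x0 (real i) s"
      by (rule obj_ind_sigmaE)
    show "map_classes Y (f x0) (real (u i)) f c \<in> obj (ind_sigma Y (f x0)) (u i)"
      unfolding s(2) cls[OF s(1)] using comp[OF s(1)]
      by (rule seq_class_in_obj)
  qed
  fix j c assume "i < j" and "c \<in> obj (ind_sigma X x0) i"
  then obtain s where s: "s \<in> inf_seqs X x0 (real i)" and c: "c = seq_class X x0 (real i) s"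
    by (blast elim: obj_ind_sigmaE)
  have sj: "s \<in> inf_seqs X x0 (real j)"
    using s \<open>i < j\<close> inf_seqs_mono[of "real i" "real j" X x0] by auto
  have "1 \<le> j" using \<open>1 \<le> i\<close> \<open>i < j\<close> by simp
  have "u i \<le> u j"
    using \<open>mono u\<close> \<open>i < j\<close> by (simp add: monoD)
  then show "bonds (ind_sigma Y (f x0)) (u i) (u j) (map_classes Y (f x0) (real (u i)) f c) =
      map_classes Y (f x0) (real (u j)) f (bonds (ind_sigma X x0) i j c)"
    using \<open>i < j\<close> s
    by (simp add: c cls bonds_ind_sigma comp map_classes_seq_class[OF f x0 bound[OF \<open>1 \<le> j\<close>] sj])
qed

text \<open>
  The sequences \<open>s\<close> and \<open>g \<circ> f \<circ> s\<close> are uniformly close, so they are identified at a level \<open>n\<close>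
  that exceeds \<open>i\<close> by at least \<open>K\<close>.
\<close>

lemma map_classes_round_trip:
  assumes f: "coarse X Y f" and g: "coarse Y X g"
    and x0: "x0 \<in> mspace X" "g (f x0) = x0"
    and K: "\<And>x. x \<in> mspace X \<Longrightarrow> mdist X (g (f x)) x \<le> K"
    and f_bound: "controlled X Y f (real i) (real m)"
    and g_bound: "controlled Y X g (real m) (real n)"
    and n: "i \<le> n" "real i + K \<le> real n"
    and c: "c \<in> obj (ind_sigma X x0) i"
  shows "map_classes X x0 (real n) g (map_classes Y (f x0) (real m) f c) = bonds (ind_sigma X x0) i n c"
proof -
  obtain s where s: "s \<in> inf_seqs X x0 (real i)" and c: "c = seq_class X x0 (real i) s"
    using c by (rule obj_ind_sigmaE)
  have y0: "f x0 \<in> mspace Y"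
    using f x0 by (auto simp: coarse_def)
  have fs: "f \<circ> s \<in> inf_seqs Y (f x0) (real m)"
    using coarse_comp_inf_seqs[OF f x0(1) f_bound s] .
  have gfs: "g \<circ> (f \<circ> s) \<in> inf_seqs X x0 (real n)"
    using coarse_comp_inf_seqs[OF g y0 g_bound fs] x0 by simp
  have "(s, g \<circ> (f \<circ> s)) \<in> seq_equiv X x0 (real n)"
  proof (rule seq_equiv_of_uniformly_close[OF s gfs])
    show "mdist X (s k) ((g \<circ> (f \<circ> s)) k) \<le> K" for k
      using K[of "s k"] s by (auto simp: inf_seqs_def mdist_commute)
  qed (use n in auto)
  moreover have "map_classes Y (f x0) (real m) f c = seq_class Y (f x0) (real m) (f \<circ> s)"
    unfolding c using map_classes_seq_class[OF f x0(1) f_bound s] .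
  moreover have "map_classes X x0 (real n) g (seq_class Y (f x0) (real m) (f \<circ> s)) =
      seq_class X x0 (real n) (g \<circ> (f \<circ> s))"
    using map_classes_seq_class[OF g y0 g_bound fs] x0 by simp
  ultimately show ?thesis
    using bonds_ind_sigma[OF n(1) s] seq_class_eqI by (metis c)
qed

theorem theorem2p3:
  fixes X :: "'a metric" and Y :: "'b metric" and x0 :: 'a and y0 :: 'b
  assumes "coarsely_equivalent X Y"
    and "x0 \<in> mspace X" and "y0 \<in> mspace Y"
  shows "dirseq_equivalent (ind_sigma X x0) (ind_sigma Y y0)"
proof -
  obtain f g where f: "coarse X Y f" and g: "coarse Y X g" and fx0: "f x0 = y0" and gy0: "g y0 = x0"
    and gf: "close_maps X X (g \<circ> f) id" and fg: "close_maps Y Y (f \<circ> g) id"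
    using pointed_coarse_equivalence[OF assms] .
  obtain K where K: "\<And>x. x \<in> mspace X \<Longrightarrow> mdist X (g (f x)) x \<le> K"
    using gf unfolding close_maps_def comp_def id_def by blast
  obtain L where L: "\<And>y. y \<in> mspace Y \<Longrightarrow> mdist Y (f (g y)) y \<le> L"
    using fg unfolding close_maps_def comp_def id_def by blast
  have "bornologous X Y f" "bornologous Y X g"
    using f g by (auto simp: coarse_def)
  \<comment> \<open>The loss in a round trip is charged to the first of its two legs: \<open>u\<close> absorbs \<open>K\<close> and \<open>v\<close>
    absorbs \<open>L\<close>.\<close>
  obtain u where u: "mono u" "\<And>n. real n + K \<le> real (u n)" "\<And>n. n \<le> u n"
    "\<And>n. 1 \<le> n \<Longrightarrow> controlled X Y f (real n) (real (u n))"
    using coarse_control_function[OF \<open>bornologous X Y f\<close>, of K] by metis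
  obtain v where v: "mono v" "\<And>n. real n + L \<le> real (v n)" "\<And>n. n \<le> v n"
    "\<And>n. 1 \<le> n \<Longrightarrow> controlled Y X g (real n) (real (v n))"
    using coarse_control_function[OF \<open>bornologous Y X g\<close>, of L] by metis
  let ?F = "\<lambda>n. map_classes Y y0 (real (u n)) f"
  let ?G = "\<lambda>n. map_classes X x0 (real (v n)) g"
  have F: "dirseq_morphism (ind_sigma X x0) (ind_sigma Y y0) u ?F"
    using dirseq_morphism_map_classes[OF f assms(2) u(1,3,4)] fx0 by simp
  have G: "dirseq_morphism (ind_sigma Y y0) (ind_sigma X x0) v ?G"
    using dirseq_morphism_map_classes[OF g assms(3) v(1,3,4)] gy0 by simp
  have "i \<le> v (u i) \<and> i \<le> u (v i) \<and>
      (\<forall>x\<in>obj (ind_sigma X x0) i. ?G (u i) (?F i x) = bonds (ind_sigma X x0) i (v (u i)) x) \<and>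
      (\<forall>y\<in>obj (ind_sigma Y y0) i. ?F (v i) (?G i y) = bonds (ind_sigma Y y0) i (u (v i)) y)"
    if "1 \<le> i" for i
  proof (intro conjI ballI)
    have "1 \<le> u i" "1 \<le> v i"
      using that u(3)[of i] v(3)[of i] by linarith+
    show le: "i \<le> v (u i)" "i \<le> u (v i)"
      using order_trans[OF u(3) v(3)] order_trans[OF v(3) u(3)] by blast+
    have "real (u i) \<le> real (v (u i))" "real (v i) \<le> real (u (v i))"
      using u(3) v(3) by simp_all
    then have K_le: "real i + K \<le> real (v (u i))" and L_le: "real i + L \<le> real (u (v i))"
      using u(2)[of i] v(2)[of i] by linarith+
    show "?G (u i) (?F i c) = bonds (ind_sigma X x0) i (v (u i)) c"
      if "c \<in> obj (ind_sigma X x0) i" for c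
      using map_classes_round_trip[OF f g assms(2) _ K u(4)[OF \<open>1 \<le> i\<close>] v(4)[OF \<open>1 \<le> u i\<close>] le(1) K_le that]
      by (simp add: fx0 gy0)
    show "?F (v i) (?G i c) = bonds (ind_sigma Y y0) i (u (v i)) c"
      if "c \<in> obj (ind_sigma Y y0) i" for c
      using map_classes_round_trip[OF g f assms(3) _ L v(4)[OF \<open>1 \<le> i\<close>] u(4)[OF \<open>1 \<le> v i\<close>] le(2) L_le that]
      by (simp add: fx0 gy0)
  qed
  then show ?thesis
    unfolding dirseq_equivalent_def
    by (intro conjI direct_sequence_ind_sigma exI[of _ u] exI[of _ ?F] exI[of _ v] exI[of _ ?G] F G) simp
qed

end
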